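(* Let $\alpha\in(0,1]$ and let $\mathbf p_1,\dots,\mathbf p_m$ be p-values for $H_1,\dots,H_m$ with arbitrary dependence. Then the simultaneous closed BY procedure $\boldsymbol{\mathcal R}^{\overline{\mathrm{BY}}}_\alpha$ controls FDR (simultaneously) at level $\alpha$: $\mathbb E_{\mathrm P}\big(\max_{R\in\boldsymbol{\mathcal R}^{\overline{\mathrm{BY}}}_\alpha}\mathrm{FDP}_{N_{\mathrm P}}(R)\big)\le\alpha$ for every $\mathrm P\in M$. If $m>1$, $\boldsymbol{\mathcal R}^{\overline{\mathrm{BY}}}_\alpha$ is a uniform improvement in simultaneity and power over the Benjamini–Yekutieli procedure $\mathbf R^{\mathrm{BY}}_\alpha$.
   Context: Setting: $M$ is a set of probability measures on a measurable space; $m\ge 1$, $[m]=\{1,\dots,m\}$; hypotheses $H_1,\dots,H_m\subseteq M$; $N_{\mathrm P}=\{i\in[m]:\mathrm P\in H_i\}$. $\mathrm{FDP}_S(R)=|R\cap S|/(|R|\vee1)$. A random variable $\mathbf p_i\in[0,1]$ is a p-value for $H_i$ if $\mathrm P(\mathbf p_i\le t)\le t$ for all $t\in[0,1]$, $\mathrm P\in H_i$. $h_k=\sum_{j=1}^k 1/j$. BY: let $\mathbf p_{(r)}$ be the $r$th smallest p-value and $\mathbf R^{(r)}$ the set of indices of the $r$ smallest p-values (ties broken by smallest index), $\mathbf R^{(0)}=\emptyset$. $\mathbf R^{\mathrm{BY}}_\alpha=\mathbf R^{(\mathbf r)}$ with $\mathbf r=\max\{r\in[m]:\mathbf p_{(r)}\le\alpha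 r/(m h_m)\}$, $\mathbf r=0$ if no such $r$ exists. Closed BY: for nonempty $S\subseteq[m]$ let $$\mathbf e_S=\sum_{i\in S}\frac{\mathbf 1\{h_{|S|}\mathbf p_i\le\alpha\}}{\alpha\,\big(\lceil |S|h_{|S|}\mathbf p_i/\alpha\rceil\vee1\big)},\qquad \mathbf e_\emptyset=0,$$ and $\boldsymbol{\mathcal R}^{\overline{\mathrm{BY}}}_\alpha=\{R\in 2^{[m]}:\mathbf e_S\ge\mathrm{FDP}_S(R)/\alpha\text{ for all }S\in 2^{[m]}\}$. Definitions. For the improvement claims, both procedures are viewed as functions of the realization $x=(\mathbf p_1,\dots,\mathbf p_m)\in[0,1]^m$. Let $\boldsymbol{\mathcal R}(x)\subseteq 2^{[m]}$ be the collection returned by a simultaneous procedure and $\mathbf S(x)\subseteq[m]$ the set returned by a classical procedure at data realization $x$. $\boldsymbol{\mathcal R}$ is a uniform simultaneity improvement over $\mathbf S$ if $\mathbf S(x)\in\boldsymbol{\mathcal R}(x)$ for every $x$ and, for at least one $x$, $\boldsymbol{\mathcal R}(x)$ also contains a nonempty set $R\ne\mathbf S(x)$. It is a uniform power improvement if for every $x$ there is $R\in\boldsymbol{\mathcal R}(x)$ with $R\supseteq\mathbf S(x)$ and, for at least one $x$, $\boldsymbol{\mathcal R}(x)$ also contains a nonempty set $R\supsetneq\mathbf S(x)$. *)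

theory Defs
  imports "HOL-Probability.Probability"
begin

text \<open>
  The index set of the hypotheses is \<open>{1..m}\<close>.  A realization of the p-values is a point of the
  cube \<open>[0,1]\<^sup>m\<close>, encoded as an extensional function \<open>{1..m} \<rightarrow>\<^sub>E {0..1}\<close>.  The harmonic number
  \<open>h\<^sub>k\<close> is the library's \<open>harm k\<close>.
\<close>

definition FDP :: "nat set \<Rightarrow> nat set \<Rightarrow> real" where
  "FDP S R = real (card (R \<inter> S)) / real (max (card R) 1)"

definition p_value :: "'w measure \<Rightarrow> 'w measure set \<Rightarrow> ('w \<Rightarrow> real) \<Rightarrow> bool" where
  "p_value A H p \<longleftrightarrow>
     p \<in> borel_measurable A \<and>
     (\<forall>\<omega>\<in>space A. p \<omega> \<in> {0..1}) \<and>
     (\<forall>P\<in>H. \<forall>t\<in>{0..1}. measure P {\<omega>\<in>space P. p \<omega> \<le> t} \<le> t)"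

definition unit_cube :: "nat \<Rightarrow> (nat \<Rightarrow> real) set" where
  "unit_cube m = ({1..m} \<rightarrow>\<^sub>E {0..1})"

text \<open>
  The function \<open>sort_key\<close> is stable, so equal p-values are ranked by smallest index.
  List positions start at \<open>0\<close>: the \<open>r\<close>th smallest p-value sits at position \<open>r - 1\<close>.
\<close>

definition ranking :: "nat \<Rightarrow> (nat \<Rightarrow> real) \<Rightarrow> nat list" where
  "ranking m x = sort_key x [1..<Suc m]"

definition ordered_p :: "nat \<Rightarrow> (nat \<Rightarrow> real) \<Rightarrow> nat \<Rightarrow> real" where
  "ordered_p m x r = x (ranking m x ! (r - 1))"

definition smallest_indices :: "nat \<Rightarrow> (nat \<Rightarrow> real) \<Rightarrow> nat \<Rightarrow> nat set" where
  "smallest_indices m x r = set (take r (ranking m x))"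

definition BY_count :: "nat \<Rightarrow> real \<Rightarrow> (nat \<Rightarrow> real) \<Rightarrow> nat" where
  "BY_count m \<alpha> x =
     (let A = {r\<in>{1..m}. ordered_p m x r \<le> \<alpha> * real r / (real m * harm m)}
      in if A = {} then 0 else Max A)"

definition BY :: "nat \<Rightarrow> real \<Rightarrow> (nat \<Rightarrow> real) \<Rightarrow> nat set" where
  "BY m \<alpha> x = smallest_indices m x (BY_count m \<alpha> x)"

text \<open>For \<open>S = {}\<close> the sum is empty, so that \<open>BY_e \<alpha> x {} = 0\<close>.\<close>

definition BY_e :: "real \<Rightarrow> (nat \<Rightarrow> real) \<Rightarrow> nat set \<Rightarrow> real" where
  "BY_e \<alpha> x S =
     (\<Sum>i\<in>S. of_bool (harm (card S) * x i \<le> \<alpha>) /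
        (\<alpha> * real_of_int (max \<lceil>real (card S) * harm (card S) * x i / \<alpha>\<rceil> 1)))"

definition closed_BY :: "nat \<Rightarrow> real \<Rightarrow> (nat \<Rightarrow> real) \<Rightarrow> nat set set" where
  "closed_BY m \<alpha> x =
     {R \<in> Pow {1..m}. \<forall>S\<in>Pow {1..m}. BY_e \<alpha> x S \<ge> FDP S R / \<alpha>}"

text \<open>
  Below, \<open>X\<close> is the set of data realizations, \<open>RR\<close> a simultaneous procedure and \<open>S\<close> a classical one.
\<close>

definition uniform_simultaneity_improvement ::
    "'x set \<Rightarrow> ('x \<Rightarrow> nat set set) \<Rightarrow> ('x \<Rightarrow> nat set) \<Rightarrow> bool" where
  "uniform_simultaneity_improvement X RR S \<longleftrightarrow>
     (\<forall>x\<in>X. S x \<in> RR x) \<and>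
     (\<exists>x\<in>X. \<exists>R\<in>RR x. R \<noteq> {} \<and> R \<noteq> S x)"

definition uniform_power_improvement ::
    "'x set \<Rightarrow> ('x \<Rightarrow> nat set set) \<Rightarrow> ('x \<Rightarrow> nat set) \<Rightarrow> bool" where
  "uniform_power_improvement X RR S \<longleftrightarrow>
     (\<forall>x\<in>X. \<exists>R\<in>RR x. S x \<subseteq> R) \<and>
     (\<exists>x\<in>X. \<exists>R\<in>RR x. R \<noteq> {} \<and> S x \<subset> R)"

text \<open>
  Simultaneous FDR control under a single \<open>P\<close> with set \<open>N\<close> of true hypotheses, for a random
  collection of rejection sets.  The library integral of a non-integrable function is \<open>0\<close>, so
  integrability is demanded explicitly.  \<open>Max\<close> is meaningful for nonempty finite collections;
  \<open>closed_BY m \<alpha> x\<close> is finite and, for \<open>\<alpha> > 0\<close>, contains \<open>{}\<close>.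
\<close>

definition simultaneous_FDR_le ::
    "'w measure \<Rightarrow> nat set \<Rightarrow> ('w \<Rightarrow> nat set set) \<Rightarrow> real \<Rightarrow> bool" where
  "simultaneous_FDR_le P N RR \<alpha> \<longleftrightarrow>
     integrable P (\<lambda>\<omega>. Max (FDP N ` RR \<omega>)) \<and>
     (\<integral>\<omega>. Max (FDP N ` RR \<omega>) \<partial>P) \<le> \<alpha>"

end

theory Submission
  imports Defs
begin

text \<open>
  For \<open>N\<close> the set of true hypotheses, every set in the closed BY collection has false discovery
  proportion at most \<open>\<alpha> * e\<^sub>N\<close>, so control follows from \<open>e\<^sub>N\<close> having expectation at most 1.
  With \<open>n = |N|\<close> and \<open>c = n h\<^sub>n / \<alpha>\<close>, each summand of \<open>\<alpha> * e\<^sub>N\<close> is \<open>1/k\<close> on \<open>(k - 1)/c < p \<le> k/c\<close> for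
  \<open>k \<le> n\<close>, and has expectation at most \<open>h\<^sub>n / c = \<alpha> / n\<close>.

  If BY rejects \<open>r\<close> hypotheses, its p-values are at most \<open>\<alpha> r / (m h\<^sub>m)\<close>; as \<open>|S| h\<^bsub>|S|\<^esub> \<le> m h\<^sub>m\<close>, each
  rejected \<open>i \<in> S\<close> contributes at least \<open>1/r\<close> to \<open>\<alpha> * e\<^sub>S\<close>, which puts the BY set into the closed
  collection.  For the point \<open>(0, \<dots>, 0, \<alpha>)\<close> the closed procedure allows rejecting everything,
  whereas BY keeps the last hypothesis because \<open>\<alpha> / h\<^sub>m < \<alpha>\<close>.
\<close>

section \<open>Elementary bounds for the false discovery proportion, the e-values and the closed
  collection\<close>

lemma FDP_le_1:
  assumes "finite R"
  shows "FDP S R \<le> 1"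
proof -
  have "card (R \<inter> S) \<le> max (card R) 1"
    using card_mono[OF assms, of "R \<inter> S"] by auto
  then show ?thesis
    by (simp add: FDP_def)
qed

lemma FDP_empty [simp]: "FDP S {} = 0"
  by (simp add: FDP_def)

lemma BY_e_nonneg:
  assumes "0 < \<alpha>"
  shows "0 \<le> BY_e \<alpha> x S"
  unfolding BY_e_def using assms by (intro sum_nonneg divide_nonneg_nonneg) auto

lemma BY_e_eq:
  "BY_e \<alpha> x S = (\<Sum>i\<in>S. of_bool (harm (card S) * x i \<le> \<alpha>) /
     real_of_int (max \<lceil>real (card S) * harm (card S) * x i / \<alpha>\<rceil> 1)) / \<alpha>"
  unfolding BY_e_def by (simp add: sum_divide_distrib mult.commute)

lemma empty_in_closed_BY:
  assumes "0 < \<alpha>"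
  shows "{} \<in> closed_BY m \<alpha> x"
  using BY_e_nonneg[OF assms] by (simp add: closed_BY_def)

lemma closed_BY_subset: "closed_BY m \<alpha> x \<subseteq> Pow {1..m}"
  by (auto simp: closed_BY_def)

lemma finite_closed_BY: "finite (closed_BY m \<alpha> x)"
  using closed_BY_subset by (rule finite_subset) simp

section \<open>Expectation of the e-values\<close>

text \<open>Summation by parts writes the BY weight as a nonnegative combination of the indicators
  \<open>y \<le> k\<close>, whose expectations the p-value property controls.\<close>

lemma of_bool_over_ceiling_eq:
  fixes y :: real
  shows "of_bool (y \<le> real (Suc n)) / real_of_int (max \<lceil>y\<rceil> 1) =
    (\<Sum>k<n. of_bool (y \<le> real (Suc k)) / (real (Suc k) * real (Suc (Suc k)))) +
    of_bool (y \<le> real (Suc n)) / real (Suc n)"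
proof (induction n)
  case 0
  have "max \<lceil>y\<rceil> 1 = 1" if "y \<le> 1"
    using that by (simp add: ceiling_le_iff)
  then show ?case
    by simp
next
  case (Suc n)
  consider "y \<le> real (Suc n)" | "real (Suc n) < y" "y \<le> real (Suc (Suc n))"
    | "real (Suc (Suc n)) < y"
    by linarith
  then show ?case
  proof cases
    case 1
    then have "y \<le> real (Suc (Suc n))" by simp
    \<comment> \<open>The left side is the same for \<open>n\<close> and \<open>Suc n\<close> here.
      On the right, the old boundary term splits into the new summand and the new boundary
      term.\<close>
    have e: "1 / real (Suc n) = 1 / (real (Suc n) * real (Suc (Suc n))) + 1 / real (Suc (Suc n))"
      by (simp add: divide_simps del: of_nat_Suc)
    show ?thesis
      using Suc.IH 1 \<open>y \<le> real (Suc (Suc n))\<close> e by (simp only: sum.lessThan_Suc of_bool_eq)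
  next
    case 2
    then have "\<lceil>y\<rceil> = int (Suc (Suc n))"
      by (intro ceiling_unique) auto
    moreover have "\<not> y \<le> real (Suc k)" if "k < Suc n" for k
      using that 2(1) by simp
    ultimately show ?thesis
      using 2(2) by simp
  next
    case 3
    then have "\<not> y \<le> real (Suc k)" if "k \<le> Suc n" for k
      using that by simp
    with 3 show ?thesis
      by simp
  qed
qed

text \<open>As \<open>n \<le> c\<close>, every level \<open>k / c\<close> with
  \<open>k \<le> n\<close> lies in the unit interval, where \<open>super\<close> applies. The
  coefficient \<open>1 / (k (k + 1))\<close> turns the bound \<open>k / c\<close> into
  \<open>1 / (c (k + 1))\<close>, which adds up to a harmonic sum.\<close>

lemma (in prob_space) expectation_of_bool_over_ceiling_le:
  fixes q :: "'a \<Rightarrow> real" and c :: real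
  assumes q [measurable]: "random_variable borel q"
    and n: "0 < n" and c: "real n \<le> c"
    and super: "\<And>t. t \<in> {0..1} \<Longrightarrow> prob {\<omega> \<in> space M. q \<omega> \<le> t} \<le> t"
  shows "expectation (\<lambda>\<omega>. of_bool (c * q \<omega> \<le> real n) / real_of_int (max \<lceil>c * q \<omega>\<rceil> 1))
    \<le> harm n / c"
proof -
  obtain n' where Suc: "n = Suc n'"
    using n by (cases n) auto
  have "0 < c"
    using n c by linarith
  have level: "expectation (\<lambda>\<omega>. of_bool (c * q \<omega> \<le> real (Suc k))) \<le> real (Suc k) / c"
    if "k \<le> n'" for k
  proof -
    have "expectation (\<lambda>\<omega>. of_bool (c * q \<omega> \<le> real (Suc k))) =
        expectation (indicator {\<omega> \<in> space M. q \<omega> \<le> real (Suc k) / c})"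
      using \<open>0 < c\<close> by (intro Bochner_Integration.integral_cong) (auto simp: field_simps indicator_def)
    also have "\<dots> = prob {\<omega> \<in> space M. q \<omega> \<le> real (Suc k) / c}"
      by simp
    also have "\<dots> \<le> real (Suc k) / c"
      using \<open>0 < c\<close> c that Suc by (intro super) auto
    finally show ?thesis .
  qed
  have int: "integrable M (\<lambda>\<omega>. of_bool (c * q \<omega> \<le> real k) :: real)" for k
    by (rule integrable_const_bound[of _ 1]) auto
  have "expectation (\<lambda>\<omega>. of_bool (c * q \<omega> \<le> real n) / real_of_int (max \<lceil>c * q \<omega>\<rceil> 1)) =
    (\<Sum>k<n'. expectation (\<lambda>\<omega>. of_bool (c * q \<omega> \<le> real (Suc k))) / (real (Suc k) * real (Suc (Suc k)))) +
    expectation (\<lambda>\<omega>. of_bool (c * q \<omega> \<le> real (Suc n'))) / real (Suc n')"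
    unfolding Suc of_bool_over_ceiling_eq using int
    by (subst Bochner_Integration.integral_add) (auto simp del: of_nat_Suc)
  also have "\<dots> \<le> (\<Sum>k<n'. (real (Suc k) / c) / (real (Suc k) * real (Suc (Suc k)))) +
    (real (Suc n') / c) / real (Suc n')"
    by (intro add_mono sum_mono divide_right_mono level) auto
  also have "\<dots> = ((\<Sum>k<n'. 1 / real (Suc (Suc k))) + 1) / c"
    by (simp add: add_divide_distrib sum_divide_distrib mult.commute del: of_nat_Suc)
  \<comment> \<open>The sum starts at \<open>1 / 2\<close>; the boundary term supplies the missing
    1.\<close>
  also have "(\<Sum>k<n'. 1 / real (Suc (Suc k))) + 1 = harm (Suc n')"
    by (induction n') (simp_all add: harm_Suc harm_expand inverse_eq_divide)
  finally show ?thesis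
    using Suc by simp
qed

text \<open>Only linearity of expectation combines the summands, which is how arbitrary dependence
  is covered.\<close>

lemma expectation_BY_e_le_1:
  assumes "prob_space P" and \<alpha>: "0 < \<alpha>" "\<alpha> \<le> 1" and "finite S"
    and meas: "\<And>i. i \<in> S \<Longrightarrow> p i \<in> borel_measurable P"
    and super: "\<And>i t. i \<in> S \<Longrightarrow> t \<in> {0..1} \<Longrightarrow> measure P {\<omega> \<in> space P. p i \<omega> \<le> t} \<le> t"
  shows "integrable P (\<lambda>\<omega>. BY_e \<alpha> (\<lambda>i. p i \<omega>) S)"
    and "(\<integral>\<omega>. BY_e \<alpha> (\<lambda>i. p i \<omega>) S \<partial>P) \<le> 1"
proof -
  interpret prob_space P by fact
  define n where "n = card S"
  define c where "c = real n * harm n / \<alpha>"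
  define f where "f i \<omega> = of_bool (harm n * p i \<omega> \<le> \<alpha>) / real_of_int (max \<lceil>c * p i \<omega>\<rceil> 1)" for i \<omega>
  have e: "BY_e \<alpha> (\<lambda>i. p i \<omega>) S = (\<Sum>i\<in>S. f i \<omega>) / \<alpha>" for \<omega>
    by (simp add: BY_e_eq f_def c_def n_def)
  have int: "integrable P (f i)" if "i \<in> S" for i
  proof (rule integrable_const_bound[of _ 1])
    note [measurable] = meas[OF that]
    show "f i \<in> borel_measurable P"
      unfolding f_def by measurable
    show "AE \<omega> in P. norm (f i \<omega>) \<le> 1"
      by (auto simp: f_def of_bool_def)
  qed
  show "integrable P (\<lambda>\<omega>. BY_e \<alpha> (\<lambda>i. p i \<omega>) S)"
    unfolding e using int by auto
  have "expectation (f i) \<le> \<alpha> / real n" if "i \<in> S" for i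
  proof -
    have n: "0 < n"
      using that \<open>finite S\<close> by (auto simp: n_def card_gt_0_iff)
    have h: "1 \<le> (harm n :: real)"
      using harm_mono[of 1 n, where 'a = real] n by (simp add: harm_expand)
    \<comment> \<open>Here \<open>\<alpha> \<le> 1\<close> enters: it makes \<open>c\<close> at
      least \<open>n\<close>, so that no level \<open>k / c\<close> exceeds 1.\<close>
    have "\<alpha> \<le> harm n"
      using \<alpha> h by linarith
    then have c: "real n \<le> c"
      using n \<alpha> by (simp add: c_def field_simps)
    have "f i = (\<lambda>\<omega>. of_bool (c * p i \<omega> \<le> real n) / real_of_int (max \<lceil>c * p i \<omega>\<rceil> 1))"
      using n \<alpha> by (simp add: f_def c_def fun_eq_iff field_simps)
    then have "expectation (f i) \<le> harm n / c"
      using expectation_of_bool_over_ceiling_le[OF meas[OF that] n c super[OF that]] by simp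
    also have "\<dots> = \<alpha> / real n"
      using h by (simp add: c_def)
    finally show ?thesis .
  qed
  then have "(\<Sum>i\<in>S. expectation (f i)) \<le> (\<Sum>i\<in>S. \<alpha> / real n)"
    by (rule sum_mono)
  \<comment> \<open>An equality unless \<open>S\<close> is empty, when the sum is 0.\<close>
  also have "\<dots> \<le> \<alpha>"
    using \<alpha> by (simp add: n_def)
  finally show "(\<integral>\<omega>. BY_e \<alpha> (\<lambda>i. p i \<omega>) S \<partial>P) \<le> 1"
    unfolding e using int \<alpha> by simp
qed

section \<open>Simultaneous FDR control\<close>

text \<open>The constraints range over all \<open>S\<close>, hence include the unknown true set
  \<open>N\<close>; that single constraint bounds all members \<open>R\<close> at once.\<close>

lemma Max_FDP_closed_BY_le:
  assumes "0 < \<alpha>" and "N \<subseteq> {1..m}"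
  shows "Max (FDP N ` closed_BY m \<alpha> x) \<le> \<alpha> * BY_e \<alpha> x N"
proof -
  have "FDP N R \<le> \<alpha> * BY_e \<alpha> x N" if "R \<in> closed_BY m \<alpha> x" for R
  proof -
    have "FDP N R / \<alpha> \<le> BY_e \<alpha> x N"
      using that assms(2) by (auto simp: closed_BY_def)
    then show ?thesis
      using assms(1) by (simp add: field_simps)
  qed
  then show ?thesis
    using finite_closed_BY[of m \<alpha> x] empty_in_closed_BY[OF assms(1), of m x]
    by (subst Max_le_iff) auto
qed

text \<open>The maximum over a random collection becomes one over a fixed index set, which makes its
  measurability evident; the filler value \<open>0\<close> is harmless because \<open>{}\<close> is in the collection.\<close>

lemma Max_FDP_closed_BY_eq:
  assumes "0 < \<alpha>"
  shows "Max (FDP N ` closed_BY m \<alpha> x) =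
    Max ((\<lambda>R. if R \<in> closed_BY m \<alpha> x then FDP N R else 0) ` Pow {1..m})"
proof -
  let ?g = "\<lambda>R. if R \<in> closed_BY m \<alpha> x then FDP N R else 0"
  have "?g ` Pow {1..m} = FDP N ` closed_BY m \<alpha> x"
  proof (intro subset_antisym image_subsetI)
    fix R assume "R \<in> Pow {1..m}"
    show "?g R \<in> FDP N ` closed_BY m \<alpha> x"
      using imageI[OF empty_in_closed_BY[OF assms], of "FDP N" m x] by simp
  next
    fix R assume "R \<in> closed_BY m \<alpha> x"
    then show "FDP N R \<in> ?g ` Pow {1..m}"
      using closed_BY_subset[of m \<alpha> x] by (intro image_eqI[of _ _ R]) auto
  qed
  then show ?thesis
    by simp
qed

lemma closed_BY_FDR_le:
  assumes "prob_space P" and \<alpha>: "0 < \<alpha>" "\<alpha> \<le> 1" and N: "N \<subseteq> {1..m}"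
    and meas: "\<And>i. i \<in> {1..m} \<Longrightarrow> p i \<in> borel_measurable P"
    and super: "\<And>i t. i \<in> N \<Longrightarrow> t \<in> {0..1} \<Longrightarrow> measure P {\<omega> \<in> space P. p i \<omega> \<le> t} \<le> t"
  shows "simultaneous_FDR_le P N (\<lambda>\<omega>. closed_BY m \<alpha> (\<lambda>i\<in>{1..m}. p i \<omega>)) \<alpha>"
proof -
  interpret prob_space P by fact
  let ?x = "\<lambda>\<omega>. \<lambda>i\<in>{1..m}. p i \<omega>"
  let ?F = "\<lambda>\<omega>. Max (FDP N ` closed_BY m \<alpha> (?x \<omega>))"
  have e_restrict: "BY_e \<alpha> (?x \<omega>) S = BY_e \<alpha> (\<lambda>i. p i \<omega>) S" if "S \<subseteq> {1..m}" for S \<omega>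
    using that by (auto simp: BY_e_def intro!: sum.cong)
  have e_meas: "(\<lambda>\<omega>. BY_e \<alpha> (\<lambda>i. p i \<omega>) S) \<in> borel_measurable P" if "S \<subseteq> {1..m}" for S
    unfolding BY_e_def
  proof (rule borel_measurable_sum)
    fix i assume "i \<in> S"
    then have [measurable]: "p i \<in> borel_measurable P"
      using that meas by auto
    show "(\<lambda>\<omega>. of_bool (harm (card S) * p i \<omega> \<le> \<alpha>) /
        (\<alpha> * real_of_int (max \<lceil>real (card S) * harm (card S) * p i \<omega> / \<alpha>\<rceil> 1)))
        \<in> borel_measurable P"
      by measurable
  qed
  have mem_meas: "Measurable.pred P (\<lambda>\<omega>. R \<in> closed_BY m \<alpha> (?x \<omega>))"
    if R: "R \<in> Pow {1..m}" for R
  proof -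
    \<comment> \<open>Membership of a fixed \<open>R\<close> is a finite conjunction of comparisons
      of e-values with constants.\<close>
    have *: "R \<in> closed_BY m \<alpha> (?x \<omega>) \<longleftrightarrow>
        (\<forall>S\<in>Pow {1..m}. FDP S R / \<alpha> \<le> BY_e \<alpha> (\<lambda>i. p i \<omega>) S)" for \<omega>
      using R e_restrict by (auto simp: closed_BY_def)
    show ?thesis
      unfolding *
    proof (rule pred_intros_finite(3))
      fix S assume "S \<in> Pow {1..m}"
      then have [measurable]: "(\<lambda>\<omega>. BY_e \<alpha> (\<lambda>i. p i \<omega>) S) \<in> borel_measurable P"
        using e_meas by auto
      show "Measurable.pred P (\<lambda>\<omega>. FDP S R / \<alpha> \<le> BY_e \<alpha> (\<lambda>i. p i \<omega>) S)"
        by measurable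
    qed simp
  qed
  have F_meas: "?F \<in> borel_measurable P"
    unfolding Max_FDP_closed_BY_eq[OF \<alpha>(1)]
    using mem_meas by (intro borel_measurable_Max measurable_If) (auto simp: pred_def)
  have F_int: "integrable P ?F"
  proof (rule integrable_const_bound[of _ 1])
    have "0 \<le> ?F \<omega> \<and> ?F \<omega> \<le> 1" for \<omega>
    proof
      show "0 \<le> ?F \<omega>"
        using finite_closed_BY[of m \<alpha> "?x \<omega>"] empty_in_closed_BY[OF \<alpha>(1), of m "?x \<omega>"]
        by (intro Max_ge) (auto intro!: image_eqI[of _ _ "{}"])
      have "FDP N R \<le> 1" if "R \<in> closed_BY m \<alpha> (?x \<omega>)" for R
        using that by (intro FDP_le_1 finite_subset[of R "{1..m}"]) (auto simp: closed_BY_def)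
      then show "?F \<omega> \<le> 1"
        using finite_closed_BY[of m \<alpha> "?x \<omega>"] empty_in_closed_BY[OF \<alpha>(1), of m "?x \<omega>"]
        by (subst Max_le_iff) auto
    qed
    then show "AE \<omega> in P. norm (?F \<omega>) \<le> 1"
      by simp
  qed (fact F_meas)
  have e: "integrable P (\<lambda>\<omega>. BY_e \<alpha> (\<lambda>i. p i \<omega>) N)" "expectation (\<lambda>\<omega>. BY_e \<alpha> (\<lambda>i. p i \<omega>) N) \<le> 1"
    using expectation_BY_e_le_1[OF \<open>prob_space P\<close> \<alpha> finite_subset[OF N finite_atLeastAtMost], of p]
      meas[OF subsetD[OF N]] super by blast+
  have "?F \<omega> \<le> \<alpha> * BY_e \<alpha> (\<lambda>i. p i \<omega>) N" for \<omega>
    using Max_FDP_closed_BY_le[OF \<alpha>(1) N, of "?x \<omega>"] e_restrict[OF N, of \<omega>] by simp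
  then have "expectation ?F \<le> expectation (\<lambda>\<omega>. \<alpha> * BY_e \<alpha> (\<lambda>i. p i \<omega>) N)"
    by (intro integral_mono F_int integrable_mult_right e)
  also have "\<dots> \<le> \<alpha>"
    using e(2) \<alpha> by (simp add: mult_left_le)
  finally show ?thesis
    using F_int by (simp add: simultaneous_FDR_le_def)
qed

section \<open>The BY rejection set and its membership in the closed collection\<close>

lemma set_ranking: "set (ranking m x) = {1..m}"
  by (auto simp: ranking_def)

lemma BY_subset: "BY m \<alpha> x \<subseteq> {1..m}"
  unfolding BY_def smallest_indices_def using set_take_subset[of _ "ranking m x"] set_ranking by blast

lemma BY_count_le: "BY_count m \<alpha> x \<le> m"
proof -
  define A where "A = {r\<in>{1..m}. ordered_p m x r \<le> \<alpha> * real r / (real m * harm m)}"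
  have "Max A \<in> A" if "A \<noteq> {}"
    using that by (intro Max_in) (auto simp: A_def)
  then show ?thesis
    by (auto simp: BY_count_def Let_def A_def)
qed

lemma card_BY: "card (BY m \<alpha> x) = BY_count m \<alpha> x"
proof -
  have "distinct (ranking m x)" "length (ranking m x) = m"
    by (simp_all add: ranking_def)
  then show ?thesis
    using BY_count_le[of m \<alpha> x]
    by (simp add: BY_def smallest_indices_def distinct_card)
qed

text \<open>The maximal rank meets its own threshold, and all smaller ranks inherit that bound by
  sortedness.\<close>

lemma BY_p_le:
  assumes "i \<in> BY m \<alpha> x"
  shows "x i \<le> \<alpha> * real (card (BY m \<alpha> x)) / (real m * harm m)"
proof -
  define A where "A = {r\<in>{1..m}. ordered_p m x r \<le> \<alpha> * real r / (real m * harm m)}"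
  define r where "r = BY_count m \<alpha> x"
  have r: "r = (if A = {} then 0 else Max A)"
    unfolding r_def BY_count_def A_def Let_def ..
  have i: "i \<in> set (take r (ranking m x))"
    using assms by (simp add: BY_def smallest_indices_def r_def)
  \<comment> \<open>Otherwise the count would default to 0 and nothing would be rejected.\<close>
  then have "A \<noteq> {}"
    using r by auto
  then have "r \<in> A"
    using r Max_in[of A] by (auto simp: A_def)
  then have rm: "1 \<le> r" "r \<le> m"
    and pr: "ordered_p m x r \<le> \<alpha> * real r / (real m * harm m)"
    by (auto simp: A_def)
  have len: "length (ranking m x) = m"
    by (simp add: ranking_def)
  obtain k where k: "k < r" "i = ranking m x ! k"
    using i by (auto simp: in_set_conv_nth)
  have "sorted (map x (ranking m x))"
    by (simp add: ranking_def)
  \<comment> \<open>Positions start at 0, so \<open>k < r\<close> means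
    \<open>k \<le> r - 1\<close>, the position of the \<open>r\<close>th smallest p-value.\<close>
  then have "x (ranking m x ! k) \<le> x (ranking m x ! (r - 1))"
    using k rm len sorted_nth_mono[of "map x (ranking m x)" k "r - 1"] by simp
  then show ?thesis
    using k pr by (simp add: ordered_p_def card_BY flip: r_def)
qed

lemma BY_in_closed_BY:
  assumes \<alpha>: "0 < \<alpha>"
  shows "BY m \<alpha> x \<in> closed_BY m \<alpha> x"
proof -
  define R where "R = BY m \<alpha> x"
  have "FDP S R / \<alpha> \<le> BY_e \<alpha> x S" if S: "S \<subseteq> {1..m}" for S
  proof (cases "R = {}")
    case True
    then show ?thesis
      using BY_e_nonneg[OF \<alpha>] by simp
  next
    case False
    define r where "r = card R"
    define s where "s = card S"
    have Rm: "R \<subseteq> {1..m}"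
      unfolding R_def by (rule BY_subset)
    have fin: "finite R" "finite S"
      using Rm S finite_subset by blast+
    have r: "0 < r" "r \<le> m"
      using False fin(1) card_mono[OF _ Rm] by (auto simp: r_def card_gt_0_iff)
    have sm: "s \<le> m"
      using card_mono[OF _ S] by (simp add: s_def)
    have hm: "0 < (harm m :: real)"
      using r by (intro harm_pos) simp
    have hs: "(harm s :: real) \<le> harm m" "0 \<le> (harm s :: real)"
      using harm_mono[OF sm, where 'a = real] by (auto simp: harm_nonneg)
    define g where "g i = of_bool (harm s * x i \<le> \<alpha>) / real_of_int (max \<lceil>real s * harm s * x i / \<alpha>\<rceil> 1)" for i
    have ge: "1 / real r \<le> g i" if i: "i \<in> R \<inter> S" for i
    proof -
      have xi: "x i \<le> \<alpha> * real r / (real m * harm m)"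
        using i BY_p_le by (auto simp: R_def r_def)
      \<comment> \<open>This chain shows that the indicator in \<open>g i\<close> equals 1; the next
        one bounds the denominator.\<close>
      have "harm s * x i \<le> harm s * (\<alpha> * real r / (real m * harm m))"
        using xi hs by (intro mult_left_mono)
      also have "\<dots> = (harm s / harm m) * (\<alpha> * (real r / real m))"
        by simp
      also have "\<dots> \<le> 1 * (\<alpha> * 1)"
        using hs hm r \<alpha> by (intro mult_mono) auto
      finally have 1: "harm s * x i \<le> \<alpha>"
        by simp
      have "real s * harm s * x i / \<alpha> \<le> real s * harm s * (\<alpha> * real r / (real m * harm m)) / \<alpha>"
        using xi hs \<alpha> by (intro divide_right_mono mult_left_mono) auto
      also have "\<dots> = (real s / real m) * (harm s / harm m) * real r"
        using \<alpha> by simp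
      also have "\<dots> \<le> 1 * 1 * real r"
        using hs hm sm by (intro mult_mono mult_right_mono) auto
      \<comment> \<open>The bound survives rounding up because \<open>r\<close> is an integer, and
        the maximum with 1 because \<open>r\<close> is positive.\<close>
      finally have "max \<lceil>real s * harm s * x i / \<alpha>\<rceil> 1 \<le> int r"
        using r by (simp add: ceiling_le_iff)
      then have "real_of_int (max \<lceil>real s * harm s * x i / \<alpha>\<rceil> 1) \<le> real r"
        by linarith
      then show ?thesis
        using 1 unfolding g_def by (simp add: frac_le)
    qed
    have "FDP S R = (\<Sum>i\<in>R \<inter> S. 1 / real r)"
      using r by (simp add: FDP_def r_def max_def)
    also have "\<dots> \<le> (\<Sum>i\<in>R \<inter> S. g i)"
      by (intro sum_mono ge)
    also have "\<dots> \<le> (\<Sum>i\<in>S. g i)"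
      using fin by (intro sum_mono2) (auto simp: g_def)
    finally show ?thesis
      using \<alpha> unfolding BY_e_eq by (simp add: g_def s_def divide_right_mono)
  qed
  then show ?thesis
    using BY_subset by (auto simp: closed_BY_def R_def)
qed

section \<open>A realization where the improvement is strict\<close>

lemma closed_BY_strict_improvement:
  assumes \<alpha>: "0 < \<alpha>" "\<alpha> \<le> 1" and m: "1 < m"
  obtains x where "x \<in> unit_cube m" "{1..m} \<in> closed_BY m \<alpha> x" "BY m \<alpha> x \<subset> {1..m}"
proof
  \<comment> \<open>The value \<open>\<alpha>\<close> just passes the indicator for
    \<open>S = {m}\<close>, with weight 1, yet exceeds \<open>\<alpha> / harm m\<close>, the largest
    threshold of BY. All other p-values have weight 1 in every \<open>S\<close>.\<close>
  define x where "x = (\<lambda>i\<in>{1..m}. if i = m then \<alpha> else 0)"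
  show "x \<in> unit_cube m"
    using \<alpha> by (auto simp: x_def unit_cube_def)
  have hm: "1 < (harm m :: real)"
    using harm_mono[of 2 m, where 'a = real] m by (simp add: harm_expand)
  have "m \<notin> BY m \<alpha> x"
  proof
    assume "m \<in> BY m \<alpha> x"
    then have "x m \<le> \<alpha> * real (card (BY m \<alpha> x)) / (real m * harm m)"
      by (rule BY_p_le)
    also have "\<dots> \<le> \<alpha> * real m / (real m * harm m)"
      using \<alpha> hm BY_count_le[of m \<alpha> x]
      by (intro divide_right_mono mult_left_mono) (auto simp: card_BY)
    also have "\<dots> = \<alpha> / harm m"
      using m by simp
    also have "\<dots> < \<alpha>"
      using \<alpha> hm m mult_strict_left_mono[OF hm \<alpha>(1)] by (subst pos_divide_less_eq) auto
    finally show False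
      using m by (simp add: x_def)
  qed
  then show "BY m \<alpha> x \<subset> {1..m}"
    using BY_subset[of m \<alpha> x] m by auto
  have "FDP S {1..m} / \<alpha> \<le> BY_e \<alpha> x S" if S: "S \<subseteq> {1..m}" for S
  proof -
    define g where "g i = of_bool (harm (card S) * x i \<le> \<alpha>) /
      real_of_int (max \<lceil>real (card S) * harm (card S) * x i / \<alpha>\<rceil> 1)" for i
    have fin: "finite S"
      using S finite_subset by blast
    have F: "FDP S {1..m} = real (card S) / real m"
      using S m by (simp add: FDP_def Int_absorb1)
    have g1: "g i = 1" if "i \<in> S - {m}" for i
      using that S \<alpha> by (auto simp: g_def x_def)
    have "real (card S) / real m \<le> (\<Sum>i\<in>S. g i)"
    proof (cases "S = {m}")
      case True
      then show ?thesis
        using \<alpha> m by (simp add: g_def x_def harm_expand)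
    next
      case False
      \<comment> \<open>For nonempty \<open>S\<close> other than \<open>{m}\<close>, removing
        \<open>m\<close> leaves at least one element and so at least half of \<open>S\<close>; then
        \<open>2 \<le> m\<close> suffices.\<close>
      have "card S \<le> m * card (S - {m})"
      proof (cases "S = {}")
        case nonempty: False
        then have "1 \<le> card (S - {m})"
          using False fin by (simp add: Suc_le_eq card_gt_0_iff) blast
        moreover have "card S \<le> card (S - {m}) + 1"
          using diff_card_le_card_Diff[of "{m}" S] by simp
        moreover have "2 * card (S - {m}) \<le> m * card (S - {m})"
          using m by (intro mult_right_mono) auto
        ultimately show ?thesis
          by linarith
      qed simp
      then have "real (card S) \<le> real m * real (card (S - {m}))"
        by (metis of_nat_le_iff of_nat_mult)
      then have "real (card S) / real m \<le> real (card (S - {m}))"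
        using m by (simp add: field_simps)
      also have "\<dots> = (\<Sum>i\<in>S - {m}. g i)"
        using g1 by simp
      also have "\<dots> \<le> (\<Sum>i\<in>S. g i)"
        using fin by (intro sum_mono2) (auto simp: g_def)
      finally show ?thesis .
    qed
    then show ?thesis
      using \<alpha> unfolding BY_e_eq F g_def by (intro divide_right_mono) auto
  qed
  then show "{1..m} \<in> closed_BY m \<alpha> x"
    by (auto simp: closed_BY_def)
qed

theorem theorem28:
  fixes A :: "'w measure"
    and M :: "'w measure set"
    and H :: "nat \<Rightarrow> 'w measure set"
    and p :: "nat \<Rightarrow> 'w \<Rightarrow> real"
    and m :: nat
    and \<alpha> :: real
  assumes "m \<ge> 1"
    and "0 < \<alpha>" and "\<alpha> \<le> 1"
    and "\<And>P. P \<in> M \<Longrightarrow> prob_space P \<and> sets P = sets A"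
    and "\<And>i. i \<in> {1..m} \<Longrightarrow> H i \<subseteq> M"
    and "\<And>i. i \<in> {1..m} \<Longrightarrow> p_value A (H i) (p i)"
  shows "(\<forall>P\<in>M. simultaneous_FDR_le P {i\<in>{1..m}. P \<in> H i}
             (\<lambda>\<omega>. closed_BY m \<alpha> (\<lambda>i\<in>{1..m}. p i \<omega>)) \<alpha>) \<and>
         (m > 1 \<longrightarrow>
            uniform_simultaneity_improvement (unit_cube m) (closed_BY m \<alpha>) (BY m \<alpha>) \<and>
            uniform_power_improvement (unit_cube m) (closed_BY m \<alpha>) (BY m \<alpha>))"
proof (intro conjI impI ballI)
  fix P assume P: "P \<in> M"
  then have "prob_space P" and sets: "sets P = sets A"
    using assms(4) by auto
  then show "simultaneous_FDR_le P {i\<in>{1..m}. P \<in> H i}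
      (\<lambda>\<omega>. closed_BY m \<alpha> (\<lambda>i\<in>{1..m}. p i \<omega>)) \<alpha>"
    using assms(2,3,6) measurable_cong_sets[OF sets refl, of borel]
    by (intro closed_BY_FDR_le) (auto simp: p_value_def)
next
  assume "1 < m"
  then obtain x where x: "x \<in> unit_cube m" "{1..m} \<in> closed_BY m \<alpha> x" "BY m \<alpha> x \<subset> {1..m}"
    using closed_BY_strict_improvement assms(2,3) by metis
  have "{1..m} \<noteq> {}"
    using \<open>1 < m\<close> by simp
  \<comment> \<open>The same realization and the full index set witness both strict parts.\<close>
  then show "uniform_simultaneity_improvement (unit_cube m) (closed_BY m \<alpha>) (BY m \<alpha>)"
    and "uniform_power_improvement (unit_cube m) (closed_BY m \<alpha>) (BY m \<alpha>)"
    using x BY_in_closed_BY[OF assms(2)]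
    unfolding uniform_simultaneity_improvement_def uniform_power_improvement_def
    by blast+
qed

end
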